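(* Let $U$ be a unitary matrix on $\mathbb{C}^N$ ($N\ge1$) with $(1,0,\dots,0)^t$ as a cyclic vector. Then there exists a unitary $V$ on $\mathbb{C}^N$ with $V(1,0,\dots,0)^t=(1,0,\dots,0)^t$ such that $VUV^{-1}$ has an $\mathcal{L}\mathcal{M}$ factorization.
   Context: A vector $v$ is cyclic for a unitary $U$ on $\mathbb{C}^N$ if $\{U^kv\}_{k\in\mathbb{Z}}$ spans $\mathbb{C}^N$. Let $\mathbb{D}=\{z\in\mathbb{C}:|z|<1\}$; for $|\alpha|\le1$ put $\rho=(1-|\alpha|^2)^{1/2}$ and $\Theta(\alpha)=\begin{pmatrix}\bar\alpha&\rho\\ \rho&-\alpha\end{pmatrix}$. An $N\times N$ matrix has an $\mathcal{L}\mathcal{M}$ factorization if it equals $\mathcal{L}\mathcal{M}$ where, for some $\alpha_0,\dots,\alpha_{N-2}\in\mathbb{D}$ and $\alpha_{N-1}\in\partial\mathbb{D}$: if $N$ is odd, $\mathcal{L}=\Theta(\alpha_0)\oplus\Theta(\alpha_2)\oplus\cdots\oplus\Theta(\alpha_{N-3})\oplus(\bar\alpha_{N-1})$ and $\mathcal{M}=\mathbf{1}_{1\times1}\oplus\Theta(\alpha_1)\oplus\Theta(\alpha_3)\oplus\cdots\oplus\Theta(\alpha_{N-2})$; if $N$ is even, $\mathcal{L}=\Theta(\alpha_0)\oplus\Theta(\alpha_2)\oplus\cdots\oplus\Theta(\alpha_{N-2})$ and $\mathcal{M}=\mathbf{1}_{1\times1}\oplus\Theta(\alpha_1)\oplus\cdots\oplus\Theta(\alpha_{N-3})\oplus(\bar\alpha_{N-1})$.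 Here $(\bar\alpha_{N-1})$ is a $1\times1$ block. *)

theory Defs
  imports "Jordan_Normal_Form.Schur_Decomposition" "Jordan_Normal_Form.VS_Connect"
begin

definition unitary_mat :: "nat \<Rightarrow> complex mat \<Rightarrow> bool" where
  "unitary_mat N U \<longleftrightarrow>
     U \<in> carrier_mat N N \<and> mat_adjoint U * U = 1\<^sub>m N \<and> U * mat_adjoint U = 1\<^sub>m N"

(* Inverses and integer powers of N x N matrices are those of HOL-Algebra in this ring;
   they carry their usual meaning on invertible matrices, in particular on unitary ones. *)
abbreviation mat_ring :: "nat \<Rightarrow> complex mat ring" where
  "mat_ring N \<equiv> ring_mat TYPE(complex) N ()"

definition cyclic_vec :: "nat \<Rightarrow> complex mat \<Rightarrow> complex vec \<Rightarrow> bool" where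
  "cyclic_vec N U v \<longleftrightarrow> v \<in> carrier_vec N \<and>
     LinearCombinations.module.span class_ring (module_vec TYPE(complex) N)
       (range (\<lambda>k::int. (U [^]\<^bsub>mat_ring N\<^esub> k) *\<^sub>v v)) = carrier_vec N"

definition Theta :: "complex \<Rightarrow> complex mat" where
  "Theta \<alpha> = (let \<rho> = complex_of_real (sqrt (1 - (cmod \<alpha>)\<^sup>2))
             in mat_of_rows_list 2 [[cnj \<alpha>, \<rho>], [\<rho>, - \<alpha>]])"

definition block1 :: "complex \<Rightarrow> complex mat" where
  "block1 c = mat 1 1 (\<lambda>_. c)"

definition LM_L :: "nat \<Rightarrow> (nat \<Rightarrow> complex) \<Rightarrow> complex mat" where
  "LM_L N \<alpha> = diag_block_mat
     (if odd N then map (\<lambda>j. Theta (\<alpha> (2 * j))) [0..<(N - 1) div 2] @ [block1 (cnj (\<alpha> (N - 1)))]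
      else map (\<lambda>j. Theta (\<alpha> (2 * j))) [0..<N div 2])"

definition LM_M :: "nat \<Rightarrow> (nat \<Rightarrow> complex) \<Rightarrow> complex mat" where
  "LM_M N \<alpha> = diag_block_mat
     (if odd N then block1 1 # map (\<lambda>j. Theta (\<alpha> (2 * j + 1))) [0..<(N - 1) div 2]
      else block1 1 # map (\<lambda>j. Theta (\<alpha> (2 * j + 1))) [0..<N div 2 - 1]
             @ [block1 (cnj (\<alpha> (N - 1)))])"

(* Only the values of \<alpha> at 0, ..., N - 1 matter; the intended use is N \<ge> 1. *)
definition has_LM_factorization :: "nat \<Rightarrow> complex mat \<Rightarrow> bool" where
  "has_LM_factorization N A \<longleftrightarrow>
     (\<exists>\<alpha> :: nat \<Rightarrow> complex.
        (\<forall>j < N - 1. cmod (\<alpha> j) < 1) \<and> cmod (\<alpha> (N - 1)) = 1 \<and>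
        A = LM_L N \<alpha> * LM_M N \<alpha>)"

end

theory Submission
  imports Defs
begin

text \<open>
  The matrix $V$ is a change of basis.  Two orthonormal bases $\chi_0, \chi_1, \ldots$ and
  $\xi_0, \xi_1, \ldots$ of $\mathbb{C}^N$ with $\chi_0 = \xi_0 = e_0$ are built simultaneously;
  with $\eta_k = U \xi_k$, the matrix with entries $\langle \eta_j, \chi_i\rangle$ is $\mathcal{L}$
  and the matrix with entries $\langle \chi_j, \xi_i\rangle$ is $\mathcal{M}$.  Their product is then
  the matrix of $U$ in the basis $\chi$.  In the language of orthogonal polynomials on the unit
  circle, $\chi$ is the CMV basis and $\xi$ the alternate CMV basis.

  The recursion is forced by the block structure.  Given unit vectors $p$ and $q$ with
  $\alpha = \langle q, p\rangle$ (the inner product being linear in its first argument) and $|\alpha| < 1$, let $p'$ be the normalized component of $p$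
  orthogonal to $q$, and $q'$ that of $q$ orthogonal to $p$.  Then
  $(p, q') = (q, p')\,\Theta(\alpha)$ (\<open>rejection_decomposition\<close>, \<open>rejection_exchange\<close>).
  In an even step $p = \eta_n$, $q = \chi_n$, which gives $\eta_{n+1} = q'$, $\chi_{n+1} = p'$ and a
  block of $\mathcal{L}$; in an odd step $p = \chi_n$, $q = \xi_n$, which gives $\chi_{n+1} = q'$,
  $\xi_{n+1} = p'$ and a block of $\mathcal{M}$.

  Orthonormality follows without any polynomials.  Each block expresses two vectors of one
  sequence by the two vectors of the other with the same indices and conversely.  Hence initial
  segments of $\chi$ and $\eta$ of even length have the same orthogonal complement, and so do
  initial segments of $\xi$ and $\chi$ of odd length.  A new vector, being a combination of one
  vector from either sequence, is orthogonal to all earlier ones (\<open>cmv_invariant\<close>).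

  As long as the earlier coefficients lie in the open disc, all vectors involved are unit vectors, and
  $|\alpha_n| \le 1$ by the Cauchy-Schwarz inequality.  There are at most $N$ orthonormal vectors, so
  there is a first $n < N$ with $|\alpha_n| = 1$.  At that step $p$ and $q$
  are parallel, so the two sequences involved have the same complement at length $n + 1$ too, and
  hence $\xi_0, \ldots, \xi_n$ and $U\xi_0, \ldots, U\xi_n$ have the same complement.  It is
  invariant under $U$ and $U^*$ and orthogonal to the cyclic vector $\xi_0$, and therefore zero;
  so $n = N - 1$ (\<open>verblunsky_terminates\<close>).
\<close>

section \<open>Inner products and orthonormal sequences\<close>

lemma cscalar_prod_combination_left:
  fixes u v w :: "complex vec"
  assumes "u \<in> carrier_vec N" "v \<in> carrier_vec N" "w \<in> carrier_vec N"
  shows "(a \<cdot>\<^sub>v u + b \<cdot>\<^sub>v v) \<bullet>c w = a * (u \<bullet>c w) + b * (v \<bullet>c w)"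
  using assms by (subst add_scalar_prod_distrib[of _ N]) auto

lemma cscalar_prod_swap:
  fixes u v :: "complex vec"
  assumes "u \<in> carrier_vec N" "v \<in> carrier_vec N"
  shows "cnj (u \<bullet>c v) = v \<bullet>c u"
proof -
  have "conjugate (conjugate v \<bullet> u) = v \<bullet>c u"
    using assms by (intro conjugate_conjugate_sprod)
  then show ?thesis
    by (simp only: conjugate_vec_sprod_comm[OF assms] conjugate_complex_def)
qed

lemma cscalar_prod_combination_right:
  fixes u v w :: "complex vec"
  assumes "u \<in> carrier_vec N" "v \<in> carrier_vec N" "w \<in> carrier_vec N"
  shows "w \<bullet>c (a \<cdot>\<^sub>v u + b \<cdot>\<^sub>v v) = cnj a * (w \<bullet>c u) + cnj b * (w \<bullet>c v)"
proof -
  have "w \<bullet>c (a \<cdot>\<^sub>v u + b \<cdot>\<^sub>v v) = cnj ((a \<cdot>\<^sub>v u + b \<cdot>\<^sub>v v) \<bullet>c w)"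
    using assms by (intro cscalar_prod_swap[symmetric, of _ N]) auto
  also have "\<dots> = cnj a * cnj (u \<bullet>c w) + cnj b * cnj (v \<bullet>c w)"
    using assms by (simp add: cscalar_prod_combination_left)
  also have "\<dots> = cnj a * (w \<bullet>c u) + cnj b * (w \<bullet>c v)"
    using assms by (simp only: cscalar_prod_swap)
  finally show ?thesis .
qed

definition orthonormal_seq :: "nat \<Rightarrow> nat \<Rightarrow> (nat \<Rightarrow> complex vec) \<Rightarrow> bool" where
  "orthonormal_seq N m A \<longleftrightarrow>
     (\<forall>i<m. A i \<in> carrier_vec N) \<and> (\<forall>i<m. \<forall>j<m. A i \<bullet>c A j = (if i = j then 1 else 0))"

definition orth_to :: "nat \<Rightarrow> (nat \<Rightarrow> complex vec) \<Rightarrow> complex vec \<Rightarrow> bool" where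
  "orth_to m A y \<longleftrightarrow> (\<forall>k<m. y \<bullet>c A k = 0)"

text \<open>Equality of the spans of two initial segments, expressed by their orthogonal complements: the
  induction over the steps only ever transports orthogonality, so that no linear combination has to
  be written down.\<close>
definition same_complement ::
  "nat \<Rightarrow> nat \<Rightarrow> (nat \<Rightarrow> complex vec) \<Rightarrow> (nat \<Rightarrow> complex vec) \<Rightarrow> bool" where
  "same_complement N m A B \<longleftrightarrow> (\<forall>y \<in> carrier_vec N. orth_to m A y \<longleftrightarrow> orth_to m B y)"

lemma same_complement_sym: "same_complement N m A B \<Longrightarrow> same_complement N m B A"
  by (auto simp: same_complement_def)

lemma orthonormal_seq_carrier: "orthonormal_seq N m A \<Longrightarrow> i < m \<Longrightarrow> A i \<in> carrier_vec N"
  by (simp add: orthonormal_seq_def)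

lemma orth_to_Suc: "orth_to (Suc m) A y \<longleftrightarrow> orth_to m A y \<and> y \<bullet>c A m = 0"
  by (auto simp: orth_to_def less_Suc_eq)

lemma orthonormal_seq_Suc:
  assumes "orthonormal_seq N m A" "A m \<in> carrier_vec N" "orth_to m A (A m)" "A m \<bullet>c A m = 1"
  shows "orthonormal_seq N (Suc m) A"
proof -
  have "A k \<bullet>c A m = 0" if "k < m" for k
    using cscalar_prod_swap[of "A m" N "A k"] assms that
    by (auto simp: orth_to_def orthonormal_seq_def)
  then show ?thesis
    using assms by (auto simp: orthonormal_seq_def orth_to_def less_Suc_eq)
qed

section \<open>Coordinates with respect to an orthonormal sequence\<close>

lemma mat_adjoint_carrier: "A \<in> carrier_mat n m \<Longrightarrow> mat_adjoint A \<in> carrier_mat m n"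
  unfolding mat_adjoint_def by (intro carrier_matI) auto

lemma mat_adjoint_index:
  fixes A :: "complex mat"
  assumes "A \<in> carrier_mat n m" "i < m" "j < n"
  shows "mat_adjoint A $$ (i, j) = cnj (A $$ (j, i))"
  using assms unfolding mat_adjoint_def by (simp add: mat_of_rows_def)

lemma mat_adjoint_adjoint:
  fixes A :: "complex mat"
  assumes "A \<in> carrier_mat n m"
  shows "mat_adjoint (mat_adjoint A) = A"
  using assms mat_adjoint_carrier[OF assms] mat_adjoint_carrier[OF mat_adjoint_carrier[OF assms]]
  by (intro eq_matI) (auto simp: mat_adjoint_index[of _ m n] mat_adjoint_index[of _ n m])

lemma cscalar_prod_mat_adjoint:
  fixes A :: "complex mat"
  assumes A: "A \<in> carrier_mat n m" and u: "u \<in> carrier_vec m" and v: "v \<in> carrier_vec n"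
  shows "(A *\<^sub>v u) \<bullet>c v = u \<bullet>c (mat_adjoint A *\<^sub>v v)"
proof -
  have "(A *\<^sub>v u) \<bullet>c v = (\<Sum>i<n. \<Sum>j<m. A $$ (i, j) * u $ j * cnj (v $ i))"
    using assms by (simp add: scalar_prod_def atLeast0LessThan sum_distrib_right)
  also have "\<dots> = (\<Sum>j<m. \<Sum>i<n. A $$ (i, j) * u $ j * cnj (v $ i))"
    by (rule sum.swap)
  also have "\<dots> = u \<bullet>c (mat_adjoint A *\<^sub>v v)"
    using assms mat_adjoint_carrier[OF A]
    by (auto simp: scalar_prod_def atLeast0LessThan sum_distrib_left cnj_sum mat_adjoint_index
        intro!: sum.cong)
  finally show ?thesis .
qed

text \<open>Multiplication by this matrix takes the coordinates with respect to $A$: its rows are the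
  conjugates of the vectors $A_i$, so its adjoint has the $A_i$ as columns.\<close>
definition coord_mat :: "nat \<Rightarrow> (nat \<Rightarrow> complex vec) \<Rightarrow> complex mat" where
  "coord_mat N A = mat N N (\<lambda>(i, j). cnj (A i $ j))"

lemma coord_mat_carrier [simp]: "coord_mat N A \<in> carrier_mat N N"
  by (simp add: coord_mat_def)

lemma coord_mat_index: "i < N \<Longrightarrow> j < N \<Longrightarrow> coord_mat N A $$ (i, j) = cnj (A i $ j)"
  by (simp add: coord_mat_def)

lemma row_coord_mat:
  "i < N \<Longrightarrow> A i \<in> carrier_vec N \<Longrightarrow> row (coord_mat N A) i = conjugate (A i)"
  by (intro eq_vecI) (auto simp: coord_mat_def)

lemma coord_mat_mult_vec_index:
  assumes "i < N" "A i \<in> carrier_vec N" "y \<in> carrier_vec N"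
  shows "(coord_mat N A *\<^sub>v y) $ i = y \<bullet>c A i"
proof -
  have "(coord_mat N A *\<^sub>v y) $ i = conjugate (A i) \<bullet> y"
    using assms by (simp add: row_coord_mat carrier_matD[OF coord_mat_carrier])
  then show ?thesis
    using assms conjugate_vec_sprod_comm[of y N "A i"] by simp
qed

lemma coord_mat_mult_index:
  assumes "i < N" "j < N" "A i \<in> carrier_vec N" "Z \<in> carrier_mat N N"
  shows "(coord_mat N A * Z) $$ (i, j) = col Z j \<bullet>c A i"
proof -
  have "(coord_mat N A * Z) $$ (i, j) = conjugate (A i) \<bullet> col Z j"
    using assms by (simp add: row_coord_mat carrier_matD[OF coord_mat_carrier])
  then show ?thesis
    using assms conjugate_vec_sprod_comm[of "col Z j" N "A i"] by simp
qed

lemma col_adjoint_coord_mat: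
  "j < N \<Longrightarrow> A j \<in> carrier_vec N \<Longrightarrow> col (mat_adjoint (coord_mat N A)) j = A j"
  using mat_adjoint_carrier[OF coord_mat_carrier[of N A]]
  by (intro eq_vecI) (auto simp: mat_adjoint_index[OF coord_mat_carrier] coord_mat_index)

lemma unitary_coord_mat:
  assumes "orthonormal_seq N N A"
  shows "unitary_mat N (coord_mat N A)"
proof -
  let ?W = "coord_mat N A"
  have c: "mat_adjoint ?W \<in> carrier_mat N N"
    by (intro mat_adjoint_carrier) simp
  have W: "dim_row ?W = N" "dim_col ?W = N"
    by (simp_all add: coord_mat_def)
  have "?W * mat_adjoint ?W = 1\<^sub>m N"
  proof (rule eq_matI)
    fix i j assume "i < dim_row (1\<^sub>m N)" "j < dim_col (1\<^sub>m N)"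
    then have "i < N" "j < N" by auto
    moreover have "A i \<in> carrier_vec N" "A j \<in> carrier_vec N"
      using calculation assms by (auto simp: orthonormal_seq_def)
    ultimately have "(?W * mat_adjoint ?W) $$ (i, j) = A j \<bullet>c A i"
      by (simp add: coord_mat_mult_index[OF _ _ _ c] col_adjoint_coord_mat del: index_mult_mat)
    then show "(?W * mat_adjoint ?W) $$ (i, j) = 1\<^sub>m N $$ (i, j)"
      using assms \<open>i < N\<close> \<open>j < N\<close> by (auto simp: orthonormal_seq_def)
  qed (use c W in auto)
  then show ?thesis
    using mat_mult_left_right_inverse[OF coord_mat_carrier c] by (auto simp: unitary_mat_def)
qed

lemma orthonormal_basis_complete:
  assumes A: "orthonormal_seq N N A" and y: "y \<in> carrier_vec N" "orth_to N A y"
  shows "y = 0\<^sub>v N"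
proof -
  let ?W = "coord_mat N A"
  have c: "mat_adjoint ?W \<in> carrier_mat N N"
    by (intro mat_adjoint_carrier) simp
  have W: "dim_row ?W = N"
    by (simp add: coord_mat_def)
  have "?W *\<^sub>v y = 0\<^sub>v N"
    using assms W
    by (intro eq_vecI)
       (auto simp: coord_mat_mult_vec_index orth_to_def orthonormal_seq_def
             simp del: index_mult_mat_vec)
  then have "(mat_adjoint ?W * ?W) *\<^sub>v y = 0\<^sub>v N"
    using c y by (subst assoc_mult_mat_vec[OF c coord_mat_carrier]) (auto intro!: eq_vecI)
  then show ?thesis
    using unitary_coord_mat[OF A] y by (simp add: unitary_mat_def)
qed

text \<open>Among more than $N$ orthonormal vectors, the vector with index $N$ would be orthogonal to a
  basis.\<close>
lemma orthonormal_seq_length_le: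
  assumes "orthonormal_seq N m A"
  shows "m \<le> N"
proof (rule ccontr)
  assume "\<not> m \<le> N"
  then have "A N \<in> carrier_vec N" "A N \<bullet>c A N = 1" "orth_to N A (A N)" "orthonormal_seq N N A"
    using assms by (auto simp: orthonormal_seq_def orth_to_def)
  then show False
    using orthonormal_basis_complete[of N A "A N"] by auto
qed

text \<open>Completing the conjugates of the $m$ vectors by zero rows to a square matrix gives a singular
  matrix, and its kernel consists of the vectors orthogonal to all of them.\<close>
lemma nonzero_orth_to_few_vectors:
  assumes "m < N" "\<And>i. i < m \<Longrightarrow> A i \<in> carrier_vec N"
  shows "\<exists>y \<in> carrier_vec N. y \<noteq> 0\<^sub>v N \<and> orth_to m A y"
proof -
  define W where "W = mat\<^sub>r N N (\<lambda>i. if i = m then 0\<^sub>v N else if i < m then conjugate (A i) else 0\<^sub>v N)"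
  have W: "W \<in> carrier_mat N N"
    by (simp add: W_def)
  have "det W = 0"
    unfolding W_def using assms by (intro det_row_0) auto
  then obtain y where y: "y \<in> carrier_vec N" "y \<noteq> 0\<^sub>v N" "W *\<^sub>v y = 0\<^sub>v N"
    using det_0_iff_vec_prod_zero_field[OF W] by auto
  have "y \<bullet>c A k = 0" if "k < m" for k
  proof -
    have "y \<bullet>c A k = conjugate (A k) \<bullet> y"
      using assms that y by (intro conjugate_vec_sprod_comm) auto
    also have "\<dots> = row W k \<bullet> y"
      using assms that by (simp add: W_def)
    also have "\<dots> = (W *\<^sub>v y) $ k"
      using assms that W by simp
    finally show ?thesis
      using y that assms by simp
  qed
  then show ?thesis
    using y by (auto simp: orth_to_def)
qed

section \<open>Unitary matrices and cyclic vectors\<close>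

lemma unitary_mat_carrier: "unitary_mat N U \<Longrightarrow> U \<in> carrier_mat N N"
  by (simp add: unitary_mat_def)

lemma unitary_mat_adjoint_carrier: "unitary_mat N U \<Longrightarrow> mat_adjoint U \<in> carrier_mat N N"
  by (intro mat_adjoint_carrier unitary_mat_carrier)

lemma monoid_mat_ring: "monoid (mat_ring N)"
  by (intro semiring.axioms semiring_mat)

lemma mat_ring_inv_eqI:
  assumes "A \<in> carrier_mat N N" "B \<in> carrier_mat N N" "A * B = 1\<^sub>m N" "B * A = 1\<^sub>m N"
  shows "inv\<^bsub>mat_ring N\<^esub> A = B"
  using monoid.inv_unique'[OF monoid_mat_ring, of A N B] assms by (simp add: ring_mat_simps)

lemma unitary_mat_isometry:
  assumes "unitary_mat N U" "u \<in> carrier_vec N" "v \<in> carrier_vec N"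
  shows "(U *\<^sub>v u) \<bullet>c (U *\<^sub>v v) = u \<bullet>c v"
proof -
  have U: "U \<in> carrier_mat N N" "mat_adjoint U * U = 1\<^sub>m N"
    using assms by (auto simp: unitary_mat_def)
  have "(U *\<^sub>v u) \<bullet>c (U *\<^sub>v v) = u \<bullet>c (mat_adjoint U *\<^sub>v (U *\<^sub>v v))"
    using U assms by (intro cscalar_prod_mat_adjoint) auto
  also have "mat_adjoint U *\<^sub>v (U *\<^sub>v v) = (mat_adjoint U * U) *\<^sub>v v"
    using assms by (intro assoc_mult_mat_vec[symmetric, OF mat_adjoint_carrier[OF U(1)] U(1)])
  finally show ?thesis
    using U assms by simp
qed

lemma unitary_mat_mult_adjoint_vec:
  assumes "unitary_mat N U" "v \<in> carrier_vec N"
  shows "U *\<^sub>v (mat_adjoint U *\<^sub>v v) = v"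
  using assms assoc_mult_mat_vec[OF _ mat_adjoint_carrier, of U N N U N v]
  by (simp add: unitary_mat_def)

lemma unitary_mat_inv:
  assumes "unitary_mat N V"
  shows "inv\<^bsub>mat_ring N\<^esub> V = mat_adjoint V"
  using assms by (intro mat_ring_inv_eqI unitary_mat_carrier unitary_mat_adjoint_carrier)
    (simp_all add: unitary_mat_def)

lemma submodule_orth_complement:
  assumes "y \<in> carrier_vec N"
  shows "submodule class_ring {v \<in> carrier_vec N. v \<bullet>c y = 0} (module_vec TYPE(complex) N)"
proof -
  interpret vec_module "TYPE(complex)" N .
  show ?thesis
    using assms
    by (unfold_locales) (auto simp: module_vec_simps class_ring_simps add_scalar_prod_distrib[of _ N])
qed

text \<open>The vectors orthogonal to $y$ form a subspace; if it contains the orbit of a cyclic vector, it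
  contains $y$ itself.\<close>
lemma cyclic_vec_orbit_complement:
  assumes cyc: "cyclic_vec N U v" and y: "y \<in> carrier_vec N"
    and carr: "\<And>k::int. (U [^]\<^bsub>mat_ring N\<^esub> k) *\<^sub>v v \<in> carrier_vec N"
    and orth: "\<And>k::int. ((U [^]\<^bsub>mat_ring N\<^esub> k) *\<^sub>v v) \<bullet>c y = 0"
  shows "y = 0\<^sub>v N"
proof -
  interpret vec_module "TYPE(complex)" N .
  have "range (\<lambda>k::int. (U [^]\<^bsub>mat_ring N\<^esub> k) *\<^sub>v v) \<subseteq> {w \<in> carrier_vec N. w \<bullet>c y = 0}"
    using carr orth by blast
  then have "span (range (\<lambda>k::int. (U [^]\<^bsub>mat_ring N\<^esub> k) *\<^sub>v v)) \<subseteq> {w \<in> carrier_vec N. w \<bullet>c y = 0}"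
    by (rule span_is_subset[OF _ submodule_orth_complement[OF y]])
  then have "y \<in> {w \<in> carrier_vec N. w \<bullet>c y = 0}"
    using cyc y unfolding cyclic_vec_def by (elim conjE) (simp only: subset_iff)
  then have "y \<bullet>c y = 0"
    by (rule CollectE) (rule conjunct2)
  then show ?thesis
    using conjugate_square_eq_0_vec[OF y] by (rule iffD1[rotated])
qed

lemma invariant_nat_pow:
  assumes U: "U \<in> carrier_mat N N" and T: "T \<subseteq> carrier_vec N" "\<And>y. y \<in> T \<Longrightarrow> U *\<^sub>v y \<in> T"
  shows "U [^]\<^bsub>mat_ring N\<^esub> (n::nat) \<in> carrier_mat N N \<and> (\<forall>y \<in> T. (U [^]\<^bsub>mat_ring N\<^esub> n) *\<^sub>v y \<in> T)"
proof (induction n)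
  case 0
  then show ?case using T by (auto simp: ring_mat_simps)
next
  case (Suc n)
  then show ?case
    using U T by (auto simp: ring_mat_simps subset_iff)
qed

text \<open>Negative powers of $U$ are inverses of positive powers, hence positive powers of $U^*$; this is
  where invariance under the adjoint enters.\<close>
lemma orbit_invariant:
  assumes U: "unitary_mat N U" and P: "P \<subseteq> carrier_vec N"
    and inv: "\<And>w. w \<in> P \<Longrightarrow> U *\<^sub>v w \<in> P" "\<And>w. w \<in> P \<Longrightarrow> mat_adjoint U *\<^sub>v w \<in> P"
    and v: "v \<in> P"
  shows "(U [^]\<^bsub>mat_ring N\<^esub> (k::int)) *\<^sub>v v \<in> P"
proof -
  have c: "U \<in> carrier_mat N N" "mat_adjoint U \<in> carrier_mat N N"
    by (rule unitary_mat_carrier[OF U], rule unitary_mat_adjoint_carrier[OF U])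
  show ?thesis
  proof (cases "k < 0")
    case False
    then show ?thesis
      unfolding int_pow_def2 if_not_P[OF False]
      using invariant_nat_pow[OF c(1) P inv(1)] v by blast
  next
    case True
    define n where "n = nat (- k)"
    define W where "W = U [^]\<^bsub>mat_ring N\<^esub> n"
    define W' where "W' = mat_adjoint U [^]\<^bsub>mat_ring N\<^esub> n"
    have W: "W \<in> carrier_mat N N" "W' \<in> carrier_mat N N" "W' *\<^sub>v v \<in> P"
      unfolding W_def W'_def
      using invariant_nat_pow[OF c(1) P inv(1)] invariant_nat_pow[OF c(2) P inv(2)] v
      by blast+
    have one: "U * mat_adjoint U = 1\<^sub>m N" "mat_adjoint U * U = 1\<^sub>m N"
      using U by (auto simp: unitary_mat_def)
    have "W * W' = 1\<^sub>m N" "W' * W = 1\<^sub>m N"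
      using monoid.pow_mult_distrib[OF monoid_mat_ring[of N], of U "mat_adjoint U" n]
        monoid.pow_mult_distrib[OF monoid_mat_ring[of N], of "mat_adjoint U" U n]
        monoid.nat_pow_one[OF monoid_mat_ring[of N], of n] c one
      by (simp_all add: ring_mat_simps W_def W'_def)
    then have "W' = inv\<^bsub>mat_ring N\<^esub> W"
      using mat_ring_inv_eqI[OF W(1,2)] by simp
    then show ?thesis
      using W(3) unfolding int_pow_def2 if_P[OF True] n_def W_def by simp
  qed
qed

text \<open>Since $T$ is invariant under $U$ and $U^*$, so is its orthogonal complement.  The latter contains
  $v$, hence the orbit of $v$, hence everything.\<close>
lemma invariant_subspace_orth_to_cyclic_vec:
  assumes U: "unitary_mat N U" and cyc: "cyclic_vec N U v"
    and T: "T \<subseteq> carrier_vec N"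
    and inv: "\<And>y. y \<in> T \<Longrightarrow> U *\<^sub>v y \<in> T" "\<And>y. y \<in> T \<Longrightarrow> mat_adjoint U *\<^sub>v y \<in> T"
    and orth: "\<And>y. y \<in> T \<Longrightarrow> v \<bullet>c y = 0"
    and y: "y \<in> T"
  shows "y = 0\<^sub>v N"
proof -
  define P where "P = {w \<in> carrier_vec N. \<forall>y \<in> T. w \<bullet>c y = 0}"
  have c: "U \<in> carrier_mat N N" "mat_adjoint U \<in> carrier_mat N N"
    by (rule unitary_mat_carrier[OF U], rule unitary_mat_adjoint_carrier[OF U])
  have "U *\<^sub>v w \<in> P" if "w \<in> P" for w
  proof -
    have "(U *\<^sub>v w) \<bullet>c y = 0" if "y \<in> T" for y
      using cscalar_prod_mat_adjoint[OF c(1), of w y] that \<open>w \<in> P\<close> T inv(2)[OF that]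
      unfolding P_def by auto
    then show ?thesis
      using that c by (auto simp: P_def)
  qed
  moreover have "mat_adjoint U *\<^sub>v w \<in> P" if "w \<in> P" for w
  proof -
    have "(mat_adjoint U *\<^sub>v w) \<bullet>c y = 0" if "y \<in> T" for y
      using cscalar_prod_mat_adjoint[OF c(2), of w y] that \<open>w \<in> P\<close> T inv(1)[OF that]
      unfolding P_def mat_adjoint_adjoint[OF c(1)] by auto
    then show ?thesis
      using that c by (auto simp: P_def)
  qed
  moreover have "v \<in> P" "P \<subseteq> carrier_vec N"
    using cyc orth by (auto simp: P_def cyclic_vec_def)
  ultimately have "(U [^]\<^bsub>mat_ring N\<^esub> (k::int)) *\<^sub>v v \<in> P" for k
    by (intro orbit_invariant[OF U])
  then have "(U [^]\<^bsub>mat_ring N\<^esub> (k::int)) *\<^sub>v v \<in> carrier_vec N"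
    "((U [^]\<^bsub>mat_ring N\<^esub> k) *\<^sub>v v) \<bullet>c y = 0" for k
    using y unfolding P_def by blast+
  then show ?thesis
    using T y by (intro cyclic_vec_orbit_complement[OF cyc, of y]) blast+
qed

section \<open>One step of the recursion\<close>

definition defect :: "complex \<Rightarrow> complex" where
  "defect \<alpha> = complex_of_real (sqrt (1 - (cmod \<alpha>)\<^sup>2))"

lemma defect_cnj [simp]: "defect (cnj \<alpha>) = defect \<alpha>"
  by (simp add: defect_def)

lemma cnj_defect [simp]: "cnj (defect \<alpha>) = defect \<alpha>"
  by (simp add: defect_def)

lemma defect_square:
  assumes "cmod \<alpha> \<le> 1"
  shows "defect \<alpha> * defect \<alpha> = 1 - \<alpha> * cnj \<alpha>"
proof -
  have "(cmod \<alpha>)\<^sup>2 \<le> 1"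
    using assms by (simp add: power_le_one)
  then show ?thesis
    by (simp add: defect_def complex_norm_square[symmetric] flip: of_real_mult of_real_power)
qed

lemma defect_nonzero:
  assumes "cmod \<alpha> < 1"
  shows "defect \<alpha> \<noteq> 0"
  using assms power_strict_mono[of "cmod \<alpha>" 1 2] by (simp add: defect_def)

text \<open>For parallel unit vectors $p$, $q$ the divisor is zero and the result is the zero vector.  The
  recursion below thus is total, but carries information only up to the first such step.\<close>
definition normalized_rejection :: "complex vec \<Rightarrow> complex vec \<Rightarrow> complex vec" where
  "normalized_rejection p q =
     (1 / defect (p \<bullet>c q)) \<cdot>\<^sub>v p + (- (p \<bullet>c q) / defect (p \<bullet>c q)) \<cdot>\<^sub>v q"

lemma normalized_rejection_carrier [simp]:
  "p \<in> carrier_vec N \<Longrightarrow> q \<in> carrier_vec N \<Longrightarrow> normalized_rejection p q \<in> carrier_vec N"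
  by (simp add: normalized_rejection_def)

context
  fixes N :: nat and p q :: "complex vec" and \<alpha> :: complex
  assumes pq: "p \<in> carrier_vec N" "q \<in> carrier_vec N"
    and unit: "p \<bullet>c p = 1" "q \<bullet>c q = 1"
    and \<alpha>: "\<alpha> = q \<bullet>c p"
begin

lemma swapped_coefficient: "p \<bullet>c q = cnj \<alpha>"
  using cscalar_prod_swap[of q N p] pq \<alpha> by simp

text \<open>That this squared norm is $1 - |\alpha|^2$ gives both the bound $|\alpha| \le 1$ and the case of equality.\<close>
lemma unit_vec_rejection_norm:
  "(p + (- cnj \<alpha>) \<cdot>\<^sub>v q) \<bullet>c (p + (- cnj \<alpha>) \<cdot>\<^sub>v q) = 1 - \<alpha> * cnj \<alpha>"
proof -
  have "p + (- cnj \<alpha>) \<cdot>\<^sub>v q = 1 \<cdot>\<^sub>v p + (- cnj \<alpha>) \<cdot>\<^sub>v q"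
    by simp
  also have "\<dots> \<bullet>c \<dots> = 1 - \<alpha> * cnj \<alpha>"
    using pq unit swapped_coefficient \<alpha>
    by (subst cscalar_prod_combination_left[of _ N], simp, simp, simp,
        subst (1 2) cscalar_prod_combination_right[of _ N]) (simp_all add: algebra_simps)
  finally show ?thesis .
qed

lemma cmod_coefficient_le_1: "cmod \<alpha> \<le> 1"
proof -
  have "0 \<le> 1 - \<alpha> * cnj \<alpha>"
    using conjugate_square_ge_0_vec unit_vec_rejection_norm by metis
  then have "(cmod \<alpha>)\<^sup>2 \<le> 1"
    by (simp add: less_eq_complex_def complex_norm_square[symmetric] flip: of_real_power)
  then show ?thesis
    using power2_le_imp_le[of "cmod \<alpha>" 1] by simp
qed

lemma parallel_if_cmod_coefficient_1:
  assumes "cmod \<alpha> = 1"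
  shows "p = cnj \<alpha> \<cdot>\<^sub>v q"
proof -
  have "\<alpha> * cnj \<alpha> = 1"
    using assms by (simp add: complex_norm_square[symmetric])
  then have "p + (- cnj \<alpha>) \<cdot>\<^sub>v q = 0\<^sub>v N"
    using unit_vec_rejection_norm pq by (subst conjugate_square_eq_0_vec[symmetric]) auto
  then have "(p + (- cnj \<alpha>) \<cdot>\<^sub>v q) $ i = 0" if "i < N" for i
    using that by simp
  then show ?thesis
    using pq by (intro eq_vecI) auto
qed

context
  assumes lt: "cmod \<alpha> < 1"
begin

lemma normalized_rejection_orth: "normalized_rejection p q \<bullet>c q = 0"
  unfolding normalized_rejection_def
  using pq unit defect_nonzero[OF lt]
  by (subst cscalar_prod_combination_left[of _ N]) (auto simp: swapped_coefficient)

lemma normalized_rejection_unit: "normalized_rejection p q \<bullet>c normalized_rejection p q = 1"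
proof -
  let ?r = "normalized_rejection p q"
  have r: "?r \<in> carrier_vec N"
    using pq by simp
  have "?r \<bullet>c p = 1 / defect \<alpha> * (1 - \<alpha> * cnj \<alpha>)"
    unfolding normalized_rejection_def
    using pq unit \<alpha> defect_nonzero[OF lt]
    by (subst cscalar_prod_combination_left[of _ N])
       (auto simp: swapped_coefficient field_simps simp flip: \<alpha>)
  also have "\<dots> = defect \<alpha>"
    using defect_square[of \<alpha>] defect_nonzero[OF lt] lt by (simp add: field_simps)
  finally have "?r \<bullet>c p = defect \<alpha>" .
  moreover have "?r \<bullet>c ?r = ?r \<bullet>c ((1 / defect \<alpha>) \<cdot>\<^sub>v p + (- cnj \<alpha> / defect \<alpha>) \<cdot>\<^sub>v q)"
    by (simp add: normalized_rejection_def swapped_coefficient)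
  ultimately show ?thesis
    using normalized_rejection_orth pq r defect_nonzero[OF lt]
    by (subst (asm) cscalar_prod_combination_right[of _ N]) auto
qed

text \<open>With $p'$ the rejection of $p$ and $q'$ that of $q$, this and the next lemma are the two columns of
  $(p, q') = (q, p')\,\Theta(\alpha)$.\<close>
lemma rejection_decomposition:
  "p = cnj \<alpha> \<cdot>\<^sub>v q + defect \<alpha> \<cdot>\<^sub>v normalized_rejection p q"
  using pq defect_nonzero[OF lt]
  by (intro eq_vecI) (auto simp: normalized_rejection_def swapped_coefficient field_simps)

lemma rejection_exchange:
  "normalized_rejection q p = defect \<alpha> \<cdot>\<^sub>v q + (- \<alpha>) \<cdot>\<^sub>v normalized_rejection p q"
proof (rule eq_vecI)
  fix i assume "i < dim_vec (defect \<alpha> \<cdot>\<^sub>v q + (- \<alpha>) \<cdot>\<^sub>v normalized_rejection p q)"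
  then have i: "i < N"
    using pq by (simp add: normalized_rejection_def)
  have "defect \<alpha> * q $ i + \<alpha> * cnj \<alpha> / defect \<alpha> * q $ i
      = (defect \<alpha> * defect \<alpha> + \<alpha> * cnj \<alpha>) / defect \<alpha> * q $ i"
    using defect_nonzero[OF lt] by (simp add: field_simps)
  also have "\<dots> = q $ i / defect \<alpha>"
    using defect_square[of \<alpha>] lt by simp
  finally show "normalized_rejection q p $ i
      = (defect \<alpha> \<cdot>\<^sub>v q + (- \<alpha>) \<cdot>\<^sub>v normalized_rejection p q) $ i"
    using pq i by (simp add: normalized_rejection_def swapped_coefficient flip: \<alpha>)
      (simp add: algebra_simps)
qed (use pq in \<open>simp add: normalized_rejection_def\<close>)

end
end

text \<open>Both $A_n$ and $B_n$ are orthogonal to the earlier vectors of $A$, the latter because it is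
  orthogonal to those of $B$, which have the same complement.  Orthogonality of $A_{n+1}$ to $A_n$
  itself is built into the rejection.\<close>
lemma orthonormal_seq_extend:
  assumes A: "orthonormal_seq N (Suc n) A" and B: "orthonormal_seq N (Suc n) B"
    and same: "same_complement N n A B" and lt: "cmod (A n \<bullet>c B n) < 1"
    and A': "A (Suc n) = normalized_rejection (B n) (A n)"
  shows "orthonormal_seq N (Suc (Suc n)) A"
proof (rule orthonormal_seq_Suc[OF A])
  have c: "A n \<in> carrier_vec N" "B n \<in> carrier_vec N"
    and u: "A n \<bullet>c A n = 1" "B n \<bullet>c B n = 1"
    using A B by (auto simp: orthonormal_seq_def)
  show "A (Suc n) \<in> carrier_vec N"
    using c by (simp add: A')
  show "A (Suc n) \<bullet>c A (Suc n) = 1"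
    unfolding A' by (rule normalized_rejection_unit[OF c(2,1) u(2,1) refl lt])
  have "orth_to n B (B n)" "orth_to n A (A n)"
    using A B by (auto simp: orth_to_def orthonormal_seq_def)
  then have "orth_to n A (A n)" "orth_to n A (B n)"
    using same c by (auto simp: same_complement_def)
  then have "orth_to n A (A (Suc n))"
    using c orthonormal_seq_carrier[OF A]
    by (auto simp: orth_to_def A' normalized_rejection_def cscalar_prod_combination_left[of _ N])
  moreover have "A (Suc n) \<bullet>c A n = 0"
    unfolding A' by (rule normalized_rejection_orth[OF c(2,1) u(2,1) refl lt])
  ultimately show "orth_to (Suc n) A (A (Suc n))"
    by (simp add: orth_to_Suc)
qed

text \<open>$B_n$ and $B_{n+1}$ are the combinations of $A_n$ and $A_{n+1}$ given by the two columns of a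
  $\Theta$ block.\<close>
lemma orth_to_extend:
  assumes c: "A n \<in> carrier_vec N" "B n \<in> carrier_vec N"
    and u: "A n \<bullet>c A n = 1" "B n \<bullet>c B n = 1"
    and lt: "cmod (A n \<bullet>c B n) < 1"
    and A': "A (Suc n) = normalized_rejection (B n) (A n)"
    and B': "B (Suc n) = normalized_rejection (A n) (B n)"
    and y: "y \<in> carrier_vec N" "orth_to (Suc (Suc n)) A y" "orth_to n B y"
  shows "orth_to (Suc (Suc n)) B y"
proof -
  have c': "A (Suc n) \<in> carrier_vec N"
    using c by (simp add: A')
  have o: "y \<bullet>c A n = 0" "y \<bullet>c A (Suc n) = 0"
    using y by (auto simp: orth_to_Suc)
  have "B n = cnj (A n \<bullet>c B n) \<cdot>\<^sub>v A n + defect (A n \<bullet>c B n) \<cdot>\<^sub>v A (Suc n)"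
    unfolding A' by (rule rejection_decomposition[OF c(2,1) u(2,1) refl lt])
  then have "y \<bullet>c B n = 0"
    using cscalar_prod_combination_right[OF c(1) c' y(1)] o by (metis add_0 mult_zero_right)
  moreover have "B (Suc n) = defect (A n \<bullet>c B n) \<cdot>\<^sub>v A n + (- (A n \<bullet>c B n)) \<cdot>\<^sub>v A (Suc n)"
    unfolding A' B' by (rule rejection_exchange[OF c(2,1) u(2,1) refl lt])
  then have "y \<bullet>c B (Suc n) = 0"
    using cscalar_prod_combination_right[OF c(1) c' y(1)] o by (metis add_0 mult_zero_right)
  ultimately show ?thesis
    using y by (simp add: orth_to_Suc)
qed

lemma cmod_cscalar_prod_swap:
  fixes u v :: "complex vec"
  assumes "u \<in> carrier_vec N" "v \<in> carrier_vec N"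
  shows "cmod (u \<bullet>c v) = cmod (v \<bullet>c u)"
  using cscalar_prod_swap[OF assms] complex_mod_cnj by metis

lemma same_complement_extend:
  assumes A: "orthonormal_seq N (Suc n) A" and B: "orthonormal_seq N (Suc n) B"
    and same: "same_complement N n A B" and lt: "cmod (A n \<bullet>c B n) < 1"
    and A': "A (Suc n) = normalized_rejection (B n) (A n)"
    and B': "B (Suc n) = normalized_rejection (A n) (B n)"
  shows "same_complement N (Suc (Suc n)) A B"
proof -
  have c: "A n \<in> carrier_vec N" "B n \<in> carrier_vec N"
    and u: "A n \<bullet>c A n = 1" "B n \<bullet>c B n = 1"
    using A B by (auto simp: orthonormal_seq_def)
  have lt': "cmod (B n \<bullet>c A n) < 1"
    using lt cmod_cscalar_prod_swap[OF c] by simp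
  show ?thesis
    unfolding same_complement_def
  proof (intro ballI iffI)
    fix y :: "complex vec" assume y: "y \<in> carrier_vec N"
    have same_y: "orth_to n A y \<longleftrightarrow> orth_to n B y"
      using same y by (simp add: same_complement_def)
    show "orth_to (Suc (Suc n)) B y" if "orth_to (Suc (Suc n)) A y"
      using orth_to_extend[of A n N B y] c u lt A' B' y that same_y by (simp add: orth_to_Suc)
    show "orth_to (Suc (Suc n)) A y" if "orth_to (Suc (Suc n)) B y"
      using orth_to_extend[of B n N A y] c u lt' A' B' y that same_y by (simp add: orth_to_Suc)
  qed
qed

text \<open>In the terminal step a $1 \times 1$ block takes the place of $\Theta$.\<close>
lemma same_complement_parallel:
  assumes same: "same_complement N n A B" and "A n \<in> carrier_vec N"
    and B: "B n = c \<cdot>\<^sub>v A n" and c: "c \<noteq> 0"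
  shows "same_complement N (Suc n) A B"
  using assms by (auto simp: same_complement_def orth_to_Suc conjugate_smult_vec)

section \<open>The two CMV bases\<close>

text \<open>The pair $(\chi_n, \xi_n)$.  An even step prescribes $U \xi_{n+1}$, whence the adjoint, which is
  the inverse of $U$, in front of the second component.\<close>
primrec cmv_pair :: "complex mat \<Rightarrow> complex vec \<Rightarrow> nat \<Rightarrow> complex vec \<times> complex vec" where
  "cmv_pair U v 0 = (v, v)"
| "cmv_pair U v (Suc n) = (case cmv_pair U v n of (c, x) \<Rightarrow>
     if even n
     then (normalized_rejection (U *\<^sub>v x) c, mat_adjoint U *\<^sub>v normalized_rejection c (U *\<^sub>v x))
     else (normalized_rejection x c, normalized_rejection c x))"

locale unitary_orbit =
  fixes N :: nat and U :: "complex mat" and v :: "complex vec"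
  assumes unitary: "unitary_mat N U"
    and v_carrier: "v \<in> carrier_vec N"
    and v_unit: "v \<bullet>c v = 1"
begin

definition \<chi> :: "nat \<Rightarrow> complex vec" where
  "\<chi> n = fst (cmv_pair U v n)"

definition \<xi> :: "nat \<Rightarrow> complex vec" where
  "\<xi> n = snd (cmv_pair U v n)"

definition \<eta> :: "nat \<Rightarrow> complex vec" where
  "\<eta> n = U *\<^sub>v \<xi> n"

definition verblunsky :: "nat \<Rightarrow> complex" where
  "verblunsky n = (if even n then \<chi> n \<bullet>c \<eta> n else \<xi> n \<bullet>c \<chi> n)"

lemma cmv_0: "\<chi> 0 = v" "\<xi> 0 = v"
  by (simp_all add: \<chi>_def \<xi>_def)

lemma cmv_carrier: "\<chi> n \<in> carrier_vec N" "\<xi> n \<in> carrier_vec N" "\<eta> n \<in> carrier_vec N"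
proof -
  have "\<chi> n \<in> carrier_vec N \<and> \<xi> n \<in> carrier_vec N"
  proof (induction n)
    case 0
    then show ?case
      by (simp add: cmv_0 v_carrier)
  next
    case (Suc n)
    then show ?case
      using unitary_mat_carrier[OF unitary] unitary_mat_adjoint_carrier[OF unitary]
      by (auto simp: \<chi>_def \<xi>_def case_prod_beta intro!: mult_mat_vec_carrier normalized_rejection_carrier)
  qed
  then show "\<chi> n \<in> carrier_vec N" "\<xi> n \<in> carrier_vec N" "\<eta> n \<in> carrier_vec N"
    using unitary_mat_carrier[OF unitary] by (auto simp: \<eta>_def)
qed

lemma cmv_Suc_even:
  assumes "even n"
  shows "\<chi> (Suc n) = normalized_rejection (\<eta> n) (\<chi> n)"
    and "\<eta> (Suc n) = normalized_rejection (\<chi> n) (\<eta> n)"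
proof -
  show "\<chi> (Suc n) = normalized_rejection (\<eta> n) (\<chi> n)"
    using assms by (simp add: \<chi>_def \<xi>_def \<eta>_def split: prod.splits)
  have "\<xi> (Suc n) = mat_adjoint U *\<^sub>v normalized_rejection (\<chi> n) (\<eta> n)"
    using assms by (simp add: \<chi>_def \<xi>_def \<eta>_def split: prod.splits)
  then show "\<eta> (Suc n) = normalized_rejection (\<chi> n) (\<eta> n)"
    unfolding \<eta>_def[of "Suc n"]
    by (simp add: unitary_mat_mult_adjoint_vec[OF unitary] cmv_carrier)
qed

lemma cmv_Suc_odd:
  assumes "odd n"
  shows "\<xi> (Suc n) = normalized_rejection (\<chi> n) (\<xi> n)"
    and "\<chi> (Suc n) = normalized_rejection (\<xi> n) (\<chi> n)"
  using assms by (simp_all add: \<chi>_def \<xi>_def split: prod.splits)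

lemma orthonormal_seq_\<eta>: "orthonormal_seq N m \<eta> \<longleftrightarrow> orthonormal_seq N m \<xi>"
proof -
  have "\<eta> i \<bullet>c \<eta> j = \<xi> i \<bullet>c \<xi> j" for i j
    unfolding \<eta>_def by (intro unitary_mat_isometry[OF unitary] cmv_carrier)
  then show ?thesis
    using cmv_carrier by (simp add: orthonormal_seq_def)
qed

text \<open>Both equalities of complements are carried along.  The one at length $n$ feeds the next step and
  is raised by it to length $n + 2$; the one at length $n + 1$ is what the step after that needs.
  Parity decides which pair of sequences has which role.\<close>
lemma cmv_invariant:
  assumes "\<And>k. k < n \<Longrightarrow> cmod (verblunsky k) < 1"
  shows "orthonormal_seq N (Suc n) \<chi> \<and> orthonormal_seq N (Suc n) \<xi> \<and>
    same_complement N (if even n then n else Suc n) \<chi> \<eta> \<and>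
    same_complement N (if even n then Suc n else n) \<xi> \<chi>"
  using assms
proof (induction n)
  case 0
  then show ?case
    by (simp add: orthonormal_seq_def same_complement_def orth_to_def cmv_0 v_carrier v_unit)
next
  case (Suc n)
  have IH: "orthonormal_seq N (Suc n) \<chi>" "orthonormal_seq N (Suc n) \<xi>"
    "same_complement N (if even n then n else Suc n) \<chi> \<eta>"
    "same_complement N (if even n then Suc n else n) \<xi> \<chi>"
    using Suc.IH Suc.prems by simp_all
  have IH_\<eta>: "orthonormal_seq N (Suc n) \<eta>"
    using IH by (simp add: orthonormal_seq_\<eta>)
  have lt: "cmod (verblunsky n) < 1"
    using Suc.prems by simp
  show ?case
  proof (cases "even n")
    case True
    have lt1: "cmod (\<chi> n \<bullet>c \<eta> n) < 1"
      using lt True by (simp add: verblunsky_def)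
    then have lt2: "cmod (\<eta> n \<bullet>c \<chi> n) < 1"
      using cmod_cscalar_prod_swap[OF cmv_carrier(1,3)] by simp
    have same: "same_complement N n \<chi> \<eta>"
      using IH True by simp
    have "orthonormal_seq N (Suc (Suc n)) \<chi>"
      using IH(1) IH_\<eta> same lt1 cmv_Suc_even(1)[OF True] by (rule orthonormal_seq_extend)
    moreover have "orthonormal_seq N (Suc (Suc n)) \<eta>"
      using IH_\<eta> IH(1) same_complement_sym[OF same] lt2 cmv_Suc_even(2)[OF True]
      by (rule orthonormal_seq_extend)
    moreover have "same_complement N (Suc (Suc n)) \<chi> \<eta>"
      using IH(1) IH_\<eta> same lt1 cmv_Suc_even[OF True] by (rule same_complement_extend)
    ultimately show ?thesis
      using IH(4) True by (simp add: orthonormal_seq_\<eta>)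
  next
    case False
    have lt1: "cmod (\<xi> n \<bullet>c \<chi> n) < 1"
      using lt False by (simp add: verblunsky_def)
    then have lt2: "cmod (\<chi> n \<bullet>c \<xi> n) < 1"
      using cmod_cscalar_prod_swap[OF cmv_carrier(2,1)] by simp
    have same: "same_complement N n \<xi> \<chi>"
      using IH False by simp
    have "orthonormal_seq N (Suc (Suc n)) \<xi>"
      using IH(2,1) same lt1 cmv_Suc_odd(1)[OF False] by (rule orthonormal_seq_extend)
    moreover have "orthonormal_seq N (Suc (Suc n)) \<chi>"
      using IH(1,2) same_complement_sym[OF same] lt2 cmv_Suc_odd(2)[OF False]
      by (rule orthonormal_seq_extend)
    moreover have "same_complement N (Suc (Suc n)) \<xi> \<chi>"
      using IH(2,1) same lt1 cmv_Suc_odd[OF False] by (rule same_complement_extend)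
    ultimately show ?thesis
      using IH(3) False by simp
  qed
qed

lemma cmv_units:
  assumes "\<And>k. k < n \<Longrightarrow> cmod (verblunsky k) < 1"
  shows "\<chi> n \<bullet>c \<chi> n = 1" "\<xi> n \<bullet>c \<xi> n = 1" "\<eta> n \<bullet>c \<eta> n = 1"
  using cmv_invariant[OF assms] orthonormal_seq_\<eta>[of "Suc n"]
  by (auto simp: orthonormal_seq_def)

lemma verblunsky_le_1:
  assumes "\<And>k. k < n \<Longrightarrow> cmod (verblunsky k) < 1"
  shows "cmod (verblunsky n) \<le> 1"
proof -
  note u = cmv_units[OF assms]
  show ?thesis
    using u cmod_coefficient_le_1[OF cmv_carrier(3,1), of n n] cmod_coefficient_le_1[OF cmv_carrier(1,2), of n n]
    by (simp add: verblunsky_def)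
qed

lemma terminal_parallel:
  assumes "\<And>k. k < n \<Longrightarrow> cmod (verblunsky k) < 1" and "cmod (verblunsky n) = 1"
  shows "even n \<Longrightarrow> \<eta> n = cnj (verblunsky n) \<cdot>\<^sub>v \<chi> n"
    and "odd n \<Longrightarrow> \<chi> n = cnj (verblunsky n) \<cdot>\<^sub>v \<xi> n"
proof -
  note u = cmv_units[OF assms(1)]
  show "\<eta> n = cnj (verblunsky n) \<cdot>\<^sub>v \<chi> n" if "even n"
    using that assms(2)
    by (intro parallel_if_cmod_coefficient_1[OF cmv_carrier(3,1) u(3,1)]) (simp_all add: verblunsky_def)
  show "\<chi> n = cnj (verblunsky n) \<cdot>\<^sub>v \<xi> n" if "odd n"
    using that assms(2)
    by (intro parallel_if_cmod_coefficient_1[OF cmv_carrier(1,2) u(1,2)]) (simp_all add: verblunsky_def)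
qed

text \<open>The terminal step extends the equality of complements at length $n$ to length $n + 1$, where the
  other one already holds; chaining both through $\chi$ compares $\xi$ with $U \xi$.\<close>
lemma terminal_invariant:
  assumes lt: "\<And>k. k < n \<Longrightarrow> cmod (verblunsky k) < 1" and eq: "cmod (verblunsky n) = 1"
  shows "same_complement N (Suc n) \<xi> \<eta>"
proof -
  note inv = cmv_invariant[of n, OF lt]
  have nz: "cnj (verblunsky n) \<noteq> 0"
    using eq by auto
  have "same_complement N (Suc n) \<chi> \<eta> \<and> same_complement N (Suc n) \<xi> \<chi>"
  proof (cases "even n")
    case True
    have "\<eta> n = cnj (verblunsky n) \<cdot>\<^sub>v \<chi> n"
      using terminal_parallel(1)[of n] lt eq True by blast
    then show ?thesis
      using inv True same_complement_parallel[of N n \<chi> \<eta>] cmv_carrier nz by simp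
  next
    case False
    have "\<chi> n = cnj (verblunsky n) \<cdot>\<^sub>v \<xi> n"
      using terminal_parallel(2)[of n] lt eq False by blast
    then show ?thesis
      using inv False same_complement_parallel[of N n \<xi> \<chi>] cmv_carrier nz by simp
  qed
  then show ?thesis
    by (auto simp: same_complement_def)
qed

lemma terminal_orth_zero:
  assumes cyc: "cyclic_vec N U v"
    and lt: "\<And>k. k < n \<Longrightarrow> cmod (verblunsky k) < 1" and eq: "cmod (verblunsky n) = 1"
    and y: "y \<in> carrier_vec N" "orth_to (Suc n) \<xi> y"
  shows "y = 0\<^sub>v N"
proof -
  define T where "T = {y \<in> carrier_vec N. orth_to (Suc n) \<xi> y}"
  note c = unitary_mat_carrier[OF unitary] unitary_mat_adjoint_carrier[OF unitary]
  have same: "orth_to (Suc n) \<xi> y \<longleftrightarrow> orth_to (Suc n) \<eta> y" if "y \<in> carrier_vec N" for y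
    using terminal_invariant[OF lt eq] that by (simp add: same_complement_def)
  have "U *\<^sub>v y \<in> T" if "y \<in> T" for y
  proof -
    have y: "y \<in> carrier_vec N" "U *\<^sub>v y \<in> carrier_vec N" "orth_to (Suc n) \<xi> y"
      using that c by (auto simp: T_def)
    have "orth_to (Suc n) \<eta> (U *\<^sub>v y)"
      using y(3) unfolding orth_to_def \<eta>_def
      by (simp add: unitary_mat_isometry[OF unitary y(1) cmv_carrier(2)])
    then show ?thesis
      using same y by (simp add: T_def)
  qed
  moreover have "mat_adjoint U *\<^sub>v y \<in> T" if "y \<in> T" for y
  proof -
    have y: "y \<in> carrier_vec N" "orth_to (Suc n) \<eta> y"
      using that same by (auto simp: T_def)
    have "(mat_adjoint U *\<^sub>v y) \<bullet>c \<xi> k = y \<bullet>c \<eta> k" for k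
      using cscalar_prod_mat_adjoint[OF c(2) y(1) cmv_carrier(2)] mat_adjoint_adjoint[OF c(1)]
      by (simp add: \<eta>_def)
    then show ?thesis
      using y c by (auto simp: T_def orth_to_def)
  qed
  moreover have "v \<bullet>c y = 0" if "y \<in> T" for y
  proof -
    have "y \<bullet>c v = 0" "y \<in> carrier_vec N"
      using that cmv_0 by (auto simp: T_def orth_to_def)
    then show ?thesis
      using cscalar_prod_swap[OF _ v_carrier, of y] by simp
  qed
  moreover have "T \<subseteq> carrier_vec N" "y \<in> T"
    using y by (auto simp: T_def)
  ultimately show ?thesis
    by (intro invariant_subspace_orth_to_cyclic_vec[OF unitary cyc, of T y])
qed

text \<open>The first coefficient of modulus $1$ exists because $N + 1$ orthonormal vectors do not.  It cannot
  occur before index $N - 1$, because fewer than $N$ vectors $\xi_k$ leave a nonzero vector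
  orthogonal to them all, contrary to cyclicity,
  nor after it, because of the bound $N$ on the number of orthonormal vectors.\<close>
lemma verblunsky_terminates:
  assumes "cyclic_vec N U v" "N \<ge> 1"
  shows "(\<forall>k < N - 1. cmod (verblunsky k) < 1) \<and> cmod (verblunsky (N - 1)) = 1"
proof -
  have "\<exists>n. \<not> cmod (verblunsky n) < 1 \<and> (\<forall>k<n. cmod (verblunsky k) < 1)"
  proof -
    have "\<exists>n. \<not> cmod (verblunsky n) < 1"
    proof (rule ccontr)
      assume "\<nexists>n. \<not> cmod (verblunsky n) < 1"
      then have "orthonormal_seq N (Suc N) \<chi>"
        using cmv_invariant[of N] by simp
      then show False
        using orthonormal_seq_length_le by fastforce
    qed
    then show ?thesis
      using exists_least_iff[of "\<lambda>n. \<not> cmod (verblunsky n) < 1"] by auto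
  qed
  then obtain n where n: "\<not> cmod (verblunsky n) < 1" "\<And>k. k < n \<Longrightarrow> cmod (verblunsky k) < 1"
    by auto
  then have eq: "cmod (verblunsky n) = 1"
    using verblunsky_le_1[of n] by simp
  have "Suc n \<le> N"
    using cmv_invariant[of n] n(2) orthonormal_seq_length_le by blast
  moreover have "\<not> Suc n < N"
    using nonzero_orth_to_few_vectors[of "Suc n" N \<xi>] cmv_carrier
      terminal_orth_zero[OF assms(1) n(2) eq] by blast
  ultimately have "n = N - 1"
    by simp
  then show ?thesis
    using n eq by simp
qed

end

section \<open>Entries of the two block diagonal factors\<close>

text \<open>Entries of $\mathcal{L}$ (for $e$ true) and of $\mathcal{M}$ (for $e$ false) alike: a block
  $\Theta(\alpha_k)$ occupies the rows and columns $k$ and $k + 1$ for each $k$ whose evenness is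
  $e$.  A final $1 \times 1$ block with entry $\bar\alpha_{N-1}$ is the upper left corner of a
  truncated $\Theta$ block, so that one formula serves both parities of $N$.\<close>
definition theta_entry :: "bool \<Rightarrow> (nat \<Rightarrow> complex) \<Rightarrow> nat \<Rightarrow> nat \<Rightarrow> complex" where
  "theta_entry e \<alpha> i j =
     (if i = j then
        (if even i = e then cnj (\<alpha> i) else if i = 0 then 1 else - \<alpha> (i - 1))
      else if j = Suc i \<and> even i = e then defect (\<alpha> i)
      else if i = Suc j \<and> even j = e then defect (\<alpha> j)
      else 0)"

lemma theta_entry_Suc:
  "theta_entry False \<alpha> (Suc i) (Suc j) = theta_entry True (\<lambda>k. \<alpha> (Suc k)) i j"
  by (auto simp: theta_entry_def)

lemma Theta_eq:
  "Theta \<alpha> = mat 2 2 (\<lambda>(i, j). if i = 0 then (if j = 0 then cnj \<alpha> else defect \<alpha>)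
                          else (if j = 0 then defect \<alpha> else - \<alpha>))"
  by (intro eq_matI)
     (auto simp: Theta_def Let_def mat_of_rows_list_def defect_def less_2_cases_iff)

lemma Theta_dim [simp]: "dim_row (Theta \<alpha>) = 2" "dim_col (Theta \<alpha>) = 2"
  by (simp_all add: Theta_eq)

lemma diag_block_mat_Thetas:
  "diag_block_mat (map (\<lambda>j. Theta (\<alpha> (2 * j))) [0..<m]) =
     mat (2 * m) (2 * m) (\<lambda>(i, j). theta_entry True \<alpha> i j)"
proof (induction m)
  case 0
  then show ?case
    by (auto intro!: eq_matI)
next
  case (Suc m)
  show ?case
  proof (rule eq_matI)
    fix i j
    assume "i < dim_row (mat (2 * Suc m) (2 * Suc m) (\<lambda>(i, j). theta_entry True \<alpha> i j))"
      and "j < dim_col (mat (2 * Suc m) (2 * Suc m) (\<lambda>(i, j). theta_entry True \<alpha> i j))"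
    then have "i < 2 * m \<or> i = 2 * m \<or> i = Suc (2 * m)" "j < 2 * m \<or> j = 2 * m \<or> j = Suc (2 * m)"
      by auto
    then show "diag_block_mat (map (\<lambda>j. Theta (\<alpha> (2 * j))) [0..<Suc m]) $$ (i, j) =
        mat (2 * Suc m) (2 * Suc m) (\<lambda>(i, j). theta_entry True \<alpha> i j) $$ (i, j)"
      by (simp only: upt_Suc_append map_append list.map diag_block_mat_last Suc.IH Let_def le0)
         (elim disjE; auto simp: Theta_eq theta_entry_def; presburger)
  qed (simp_all only: upt_Suc_append map_append list.map diag_block_mat_last Suc.IH Let_def le0, simp_all)
qed

lemma diag_block_mat_Thetas_last:
  "diag_block_mat (map (\<lambda>j. Theta (\<alpha> (2 * j))) [0..<m] @ [block1 (cnj (\<alpha> (2 * m)))]) =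
     mat (Suc (2 * m)) (Suc (2 * m)) (\<lambda>(i, j). theta_entry True \<alpha> i j)"
  unfolding diag_block_mat_last diag_block_mat_Thetas Let_def
  by (rule eq_matI) (auto simp: block1_def theta_entry_def less_Suc_eq)

text \<open>Behind its leading $1 \times 1$ block, $\mathcal{M}$ is an $\mathcal{L}$ with coefficients shifted
  by one.\<close>
lemma diag_block_mat_one_first:
  assumes "diag_block_mat Bs = mat n n (\<lambda>(i, j). theta_entry True (\<lambda>k. \<alpha> (Suc k)) i j)"
  shows "diag_block_mat (block1 1 # Bs) = mat (Suc n) (Suc n) (\<lambda>(i, j). theta_entry False \<alpha> i j)"
proof -
  have [simp]: "i - Suc 0 = i \<longleftrightarrow> i = 0" for i
    by auto
  show ?thesis
    unfolding diag_block_mat.simps assms Let_def theta_entry_Suc[symmetric]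
    by (rule eq_matI) (auto simp: block1_def theta_entry_def gr0_conv_Suc)
qed

lemma LM_L_eq: "LM_L N \<alpha> = mat N N (\<lambda>(i, j). theta_entry True \<alpha> i j)"
proof (cases "odd N")
  case True
  then obtain m where "N = Suc (2 * m)"
    by (auto elim: oddE)
  then show ?thesis
    using diag_block_mat_Thetas_last[of \<alpha> m] by (simp add: LM_L_def)
next
  case False
  then obtain m where "N = 2 * m"
    by auto
  then show ?thesis
    using diag_block_mat_Thetas[of \<alpha> m] by (simp add: LM_L_def)
qed

lemma LM_M_eq:
  assumes "N \<ge> 1"
  shows "LM_M N \<alpha> = mat N N (\<lambda>(i, j). theta_entry False \<alpha> i j)"
proof (cases "odd N")
  case True
  then obtain m where "N = Suc (2 * m)"
    by (auto elim: oddE)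
  then show ?thesis
    using diag_block_mat_one_first[OF diag_block_mat_Thetas[of "\<lambda>k. \<alpha> (Suc k)" m]]
    by (simp add: LM_M_def)
next
  case False
  then obtain m where "N = 2 * Suc m"
    using assms by (metis Suc_pred dvdE gr0I mult_0_right not_one_le_zero)
  then show ?thesis
    using diag_block_mat_one_first[OF diag_block_mat_Thetas_last[of "\<lambda>k. \<alpha> (Suc k)" m]]
    by (simp add: LM_M_def)
qed

text \<open>If the vectors of $B$ arise from the basis $A$ by $\Theta$ blocks placed as in $\mathcal{L}$ or
  $\mathcal{M}$, orthonormality of $A$ lets the inner products read off the entries of the blocks.\<close>
lemma theta_entry_inner_products:
  assumes A: "orthonormal_seq N N A"
    and pair: "\<And>k. Suc k < N \<Longrightarrow> even k = e \<Longrightarrow>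
        B k = cnj (\<alpha> k) \<cdot>\<^sub>v A k + defect (\<alpha> k) \<cdot>\<^sub>v A (Suc k)"
      "\<And>k. Suc k < N \<Longrightarrow> even k = e \<Longrightarrow>
        B (Suc k) = defect (\<alpha> k) \<cdot>\<^sub>v A k + (- \<alpha> k) \<cdot>\<^sub>v A (Suc k)"
    and last: "even (N - 1) = e \<Longrightarrow> B (N - 1) = cnj (\<alpha> (N - 1)) \<cdot>\<^sub>v A (N - 1)"
    and first: "\<not> e \<Longrightarrow> B 0 = A 0"
    and ij: "i < N" "j < N"
  shows "B j \<bullet>c A i = theta_entry e \<alpha> i j"
proof -
  have c: "A k \<in> carrier_vec N" if "k < N" for k
    using A that by (rule orthonormal_seq_carrier)
  have ip: "A k \<bullet>c A i = (if k = i then 1 else 0)" if "k < N" for k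
    using A that ij by (simp add: orthonormal_seq_def)
  consider "even j = e" "Suc j < N" | "even j = e" "j = N - 1" | "even j \<noteq> e" "j = 0"
    | k where "even k = e" "j = Suc k"
  proof (cases "even j = e")
    case True
    then show ?thesis
      using that(1,2) ij by (cases "Suc j < N") auto
  next
    case False
    then show ?thesis
      using that(3,4) by (cases j) auto
  qed
  then show ?thesis
  proof cases
    case 1
    then show ?thesis
      using pair(1)[of j] c ij by (auto simp: cscalar_prod_combination_left[of _ N] ip theta_entry_def)
  next
    case 2
    then have "Suc j = N"
      using ij by simp
    have "B j \<bullet>c A i = cnj (\<alpha> j) * (A j \<bullet>c A i)"
      using 2 last c ij by (simp add: smult_scalar_prod_distrib[of _ N])
    then show ?thesis
      using \<open>even j = e\<close> \<open>Suc j = N\<close> ij by (auto simp: ip theta_entry_def)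
  next
    case 3
    then show ?thesis
      using first c ij by (auto simp: ip theta_entry_def)
  next
    case 4
    then show ?thesis
      using pair(2)[of k] c ij by (auto simp: cscalar_prod_combination_left[of _ N] ip theta_entry_def)
  qed
qed

section \<open>The factorization\<close>

context unitary_orbit
begin

lemma cmv_relations_even:
  assumes lt: "\<And>k. k \<le> n \<Longrightarrow> cmod (verblunsky k) < 1" and "even n"
  shows "\<eta> n = cnj (verblunsky n) \<cdot>\<^sub>v \<chi> n + defect (verblunsky n) \<cdot>\<^sub>v \<chi> (Suc n)"
    and "\<eta> (Suc n) = defect (verblunsky n) \<cdot>\<^sub>v \<chi> n + (- verblunsky n) \<cdot>\<^sub>v \<chi> (Suc n)"
proof -
  have u: "\<chi> n \<bullet>c \<chi> n = 1" "\<eta> n \<bullet>c \<eta> n = 1"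
    using cmv_units[of n] lt by auto
  have \<alpha>: "verblunsky n = \<chi> n \<bullet>c \<eta> n"
    using assms by (simp add: verblunsky_def)
  show "\<eta> n = cnj (verblunsky n) \<cdot>\<^sub>v \<chi> n + defect (verblunsky n) \<cdot>\<^sub>v \<chi> (Suc n)"
    unfolding cmv_Suc_even[OF \<open>even n\<close>]
    by (rule rejection_decomposition[OF cmv_carrier(3,1) u(2,1) \<alpha> lt]) simp
  show "\<eta> (Suc n) = defect (verblunsky n) \<cdot>\<^sub>v \<chi> n + (- verblunsky n) \<cdot>\<^sub>v \<chi> (Suc n)"
    unfolding cmv_Suc_even[OF \<open>even n\<close>]
    by (rule rejection_exchange[OF cmv_carrier(3,1) u(2,1) \<alpha> lt]) simp
qed

lemma cmv_relations_odd:
  assumes lt: "\<And>k. k \<le> n \<Longrightarrow> cmod (verblunsky k) < 1" and "odd n"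
  shows "\<chi> n = cnj (verblunsky n) \<cdot>\<^sub>v \<xi> n + defect (verblunsky n) \<cdot>\<^sub>v \<xi> (Suc n)"
    and "\<chi> (Suc n) = defect (verblunsky n) \<cdot>\<^sub>v \<xi> n + (- verblunsky n) \<cdot>\<^sub>v \<xi> (Suc n)"
proof -
  have u: "\<chi> n \<bullet>c \<chi> n = 1" "\<xi> n \<bullet>c \<xi> n = 1"
    using cmv_units[of n] lt by auto
  have \<alpha>: "verblunsky n = \<xi> n \<bullet>c \<chi> n"
    using assms by (simp add: verblunsky_def)
  show "\<chi> n = cnj (verblunsky n) \<cdot>\<^sub>v \<xi> n + defect (verblunsky n) \<cdot>\<^sub>v \<xi> (Suc n)"
    unfolding cmv_Suc_odd[OF \<open>odd n\<close>]
    by (rule rejection_decomposition[OF cmv_carrier(1,2) u(1,2) \<alpha> lt]) simp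
  show "\<chi> (Suc n) = defect (verblunsky n) \<cdot>\<^sub>v \<xi> n + (- verblunsky n) \<cdot>\<^sub>v \<xi> (Suc n)"
    unfolding cmv_Suc_odd[OF \<open>odd n\<close>]
    by (rule rejection_exchange[OF cmv_carrier(1,2) u(1,2) \<alpha> lt]) simp
qed

lemma cmv_bases:
  assumes "cyclic_vec N U v" "N \<ge> 1"
  shows "orthonormal_seq N N \<chi>" "orthonormal_seq N N \<xi>"
  using cmv_invariant[of "N - 1"] verblunsky_terminates[OF assms] \<open>N \<ge> 1\<close> by simp_all

text \<open>With $V$ and $X$ the coordinate matrices of $\chi$ and $\xi$, the factors are
  $\mathcal{L} = V U X^*$ and $\mathcal{M} = X V^*$, and $X^* X = 1$ cancels between them.\<close>
lemma LM_factorization_in_cmv_basis: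
  assumes cyc: "cyclic_vec N U v" and N: "N \<ge> 1"
  defines "V \<equiv> coord_mat N \<chi>"
  shows "has_LM_factorization N (V * U * mat_adjoint V)"
proof -
  define X where "X = coord_mat N \<xi>"
  note basis = cmv_bases[OF cyc N]
  have lt: "cmod (verblunsky k) < 1" if "Suc k < N" for k
    using verblunsky_terminates[OF cyc N] that by auto
  have lt': "cmod (verblunsky k) < 1" if "k < N - 1" for k
    using lt that by auto
  have eq: "cmod (verblunsky (N - 1)) = 1"
    using verblunsky_terminates[OF cyc N] by auto
  have c: "V \<in> carrier_mat N N" "X \<in> carrier_mat N N" "U \<in> carrier_mat N N"
    "mat_adjoint V \<in> carrier_mat N N" "mat_adjoint X \<in> carrier_mat N N"
    unfolding V_def X_def
    by (intro coord_mat_carrier unitary_mat_carrier[OF unitary] mat_adjoint_carrier)+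
  have L: "LM_L N verblunsky = V * (U * mat_adjoint X)"
  proof (rule eq_matI)
    fix i j assume "i < dim_row (V * (U * mat_adjoint X))" "j < dim_col (V * (U * mat_adjoint X))"
    then have ij: "i < N" "j < N"
      using c by auto
    have "(V * (U * mat_adjoint X)) $$ (i, j) = col (U * mat_adjoint X) j \<bullet>c \<chi> i"
      unfolding V_def by (rule coord_mat_mult_index[OF ij cmv_carrier(1) mult_carrier_mat[OF c(3,5)]])
    also have "col (U * mat_adjoint X) j = \<eta> j"
      using col_mult2[OF c(3,5) ij(2)] col_adjoint_coord_mat[of j N \<xi>, OF ij(2) cmv_carrier(2)]
      by (simp add: \<eta>_def X_def)
    also have "\<eta> j \<bullet>c \<chi> i = theta_entry True verblunsky i j"
    proof (rule theta_entry_inner_products[OF basis(1)])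
      fix k assume k: "Suc k < N" "even k = True"
      show "\<eta> k = cnj (verblunsky k) \<cdot>\<^sub>v \<chi> k + defect (verblunsky k) \<cdot>\<^sub>v \<chi> (Suc k)"
        using k by (intro cmv_relations_even(1) lt) auto
      show "\<eta> (Suc k) = defect (verblunsky k) \<cdot>\<^sub>v \<chi> k + (- verblunsky k) \<cdot>\<^sub>v \<chi> (Suc k)"
        using k by (intro cmv_relations_even(2) lt) auto
    next
      assume "even (N - 1) = True"
      then show "\<eta> (N - 1) = cnj (verblunsky (N - 1)) \<cdot>\<^sub>v \<chi> (N - 1)"
        by (intro terminal_parallel(1)[OF lt' eq]) simp_all
    qed (use ij in simp_all)
    finally show "LM_L N verblunsky $$ (i, j) = (V * (U * mat_adjoint X)) $$ (i, j)"
      using ij by (simp add: LM_L_eq)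
  qed (use c in \<open>simp_all add: LM_L_eq\<close>)
  have M: "LM_M N verblunsky = X * mat_adjoint V"
  proof (rule eq_matI)
    fix i j assume "i < dim_row (X * mat_adjoint V)" "j < dim_col (X * mat_adjoint V)"
    then have ij: "i < N" "j < N"
      using c by auto
    have "(X * mat_adjoint V) $$ (i, j) = col (mat_adjoint V) j \<bullet>c \<xi> i"
      unfolding X_def by (rule coord_mat_mult_index[OF ij cmv_carrier(2) c(4)])
    also have "col (mat_adjoint V) j = \<chi> j"
      unfolding V_def by (rule col_adjoint_coord_mat[OF ij(2) cmv_carrier(1)])
    also have "\<chi> j \<bullet>c \<xi> i = theta_entry False verblunsky i j"
    proof (rule theta_entry_inner_products[OF basis(2)])
      fix k assume k: "Suc k < N" "even k = False"
      show "\<chi> k = cnj (verblunsky k) \<cdot>\<^sub>v \<xi> k + defect (verblunsky k) \<cdot>\<^sub>v \<xi> (Suc k)"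
        using k by (intro cmv_relations_odd(1) lt) auto
      show "\<chi> (Suc k) = defect (verblunsky k) \<cdot>\<^sub>v \<xi> k + (- verblunsky k) \<cdot>\<^sub>v \<xi> (Suc k)"
        using k by (intro cmv_relations_odd(2) lt) auto
    next
      assume "even (N - 1) = False"
      then show "\<chi> (N - 1) = cnj (verblunsky (N - 1)) \<cdot>\<^sub>v \<xi> (N - 1)"
        by (intro terminal_parallel(2)[OF lt' eq]) simp_all
    qed (use ij cmv_0 in simp_all)
    finally show "LM_M N verblunsky $$ (i, j) = (X * mat_adjoint V) $$ (i, j)"
      using ij N by (simp add: LM_M_eq)
  qed (use c N in \<open>simp_all add: LM_M_eq\<close>)
  have "mat_adjoint X * X = 1\<^sub>m N"
    using unitary_coord_mat[OF basis(2)] by (simp add: unitary_mat_def X_def)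
  then have "LM_L N verblunsky * LM_M N verblunsky = V * U * mat_adjoint V"
    unfolding L M using c
    by (simp add: assoc_mult_mat[of _ N N _ N _ N] flip: assoc_mult_mat[of "mat_adjoint X" N N X N _ N])
  then show ?thesis
    unfolding has_LM_factorization_def using lt' eq by metis
qed

end

theorem theorem10:
  fixes N :: nat and U :: "complex mat"
  assumes "N \<ge> 1"
    and "unitary_mat N U"
    and "cyclic_vec N U (unit_vec N 0)"
  shows "\<exists>V. unitary_mat N V \<and> V *\<^sub>v unit_vec N 0 = unit_vec N 0 \<and>
           has_LM_factorization N (V * U * inv\<^bsub>mat_ring N\<^esub> V)"
proof -
  interpret unitary_orbit N U "unit_vec N 0"
    using assms by unfold_locales (auto simp: scalar_prod_left_unit)
  let ?V = "coord_mat N \<chi>"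
  have basis: "orthonormal_seq N N \<chi>"
    by (rule cmv_bases[OF assms(3,1)])
  then have V: "unitary_mat N ?V"
    by (rule unitary_coord_mat)
  have "?V *\<^sub>v unit_vec N 0 = unit_vec N 0"
  proof (rule eq_vecI)
    fix i assume "i < dim_vec (unit_vec N 0 :: complex vec)"
    then have i: "i < N"
      by simp
    have "(?V *\<^sub>v unit_vec N 0) $ i = \<chi> 0 \<bullet>c \<chi> i"
      unfolding cmv_0 by (rule coord_mat_mult_vec_index[OF i cmv_carrier(1) v_carrier])
    then show "(?V *\<^sub>v unit_vec N 0) $ i = unit_vec N 0 $ i"
      using basis i assms(1) by (simp add: orthonormal_seq_def)
  qed (simp add: coord_mat_def)
  moreover have "has_LM_factorization N (?V * U * inv\<^bsub>mat_ring N\<^esub> ?V)"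
    unfolding unitary_mat_inv[OF V] by (rule LM_factorization_in_cmv_basis[OF assms(3,1)])
  ultimately show ?thesis
    using V by blast
qed

end
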